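(* Let $\{W_1,\ldots,W_f\}$ be a set of mutually quasi-unbiased weighing matrices for parameters $(d,d,d/2,2d)$. Then $f\leq d$.
   Context: A weighing matrix of order $d$ and weight $k$ is a $d\times d$ matrix $W$ with entries in $\{0,\pm1\}$ with $WW^T=kI$. Two weighing matrices $W_1,W_2$ of order $d$ and weight $k$ are quasi-unbiased for parameters $(d,k,l,a)$ (with $a,l$ positive integers) if $\frac{1}{\sqrt a}W_1W_2^T$ is a weighing matrix of weight $l$. A set of weighing matrices is a set of mutually quasi-unbiased weighing matrices for parameters $(d,k,l,a)$ if any two distinct members are quasi-unbiased for parameters $(d,k,l,a)$.
   Formalization: The case d = 2 is excluded, since the claim fails there: for parameters (2,2,1,4), signed row permutations of a Hadamard matrix of order 2 are mutually quasi-unbiased, which gives sets with f = 3 > d. *)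

theory Defs
  imports Complex_Main "Jordan_Normal_Form.Matrix"
begin

definition weighing_matrix :: "nat \<Rightarrow> nat \<Rightarrow> real mat \<Rightarrow> bool" where
  "weighing_matrix d k W \<longleftrightarrow>
     W \<in> carrier_mat d d \<and>
     (\<forall>i<d. \<forall>j<d. W $$ (i, j) \<in> {0, 1, -1}) \<and>
     W * transpose_mat W = real k \<cdot>\<^sub>m 1\<^sub>m d"

definition quasi_unbiased ::
  "nat \<Rightarrow> nat \<Rightarrow> nat \<Rightarrow> nat \<Rightarrow> real mat \<Rightarrow> real mat \<Rightarrow> bool" where
  "quasi_unbiased d k l a W\<^sub>1 W\<^sub>2 \<longleftrightarrow>
     0 < l \<and> 0 < a \<and>
     weighing_matrix d k W\<^sub>1 \<and> weighing_matrix d k W\<^sub>2 \<and>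
     weighing_matrix d l ((1 / sqrt (real a)) \<cdot>\<^sub>m (W\<^sub>1 * transpose_mat W\<^sub>2))"

text \<open>The conjuncts beyond \<open>pairwise\<close> matter only for sets with at most one element,
  where they keep the members weighing matrices and the parameters positive.\<close>

definition mutually_quasi_unbiased ::
  "nat \<Rightarrow> nat \<Rightarrow> nat \<Rightarrow> nat \<Rightarrow> real mat set \<Rightarrow> bool" where
  "mutually_quasi_unbiased d k l a S \<longleftrightarrow>
     0 < l \<and> 0 < a \<and>
     (\<forall>W\<in>S. weighing_matrix d k W) \<and>
     pairwise (quasi_unbiased d k l a) S"

text \<open>For \<open>d = 2\<close> the parameters \<open>(d, d, d/2, 2d) = (2, 2, 1, 4)\<close> are degenerate: a weighing
  matrix of weight 1 is a signed permutation matrix, so \<open>W\<close> is quasi-unbiased with every matrix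
  obtained from it by permuting and negating rows. Hence the bound \<open>f \<le> d\<close> fails there.\<close>

lemma order_two_exceeds_bound:
  "\<exists>W :: nat \<Rightarrow> real mat. inj_on W {1..3} \<and> mutually_quasi_unbiased 2 2 1 4 (W ` {1..3})"
proof -
  define A B C :: "real mat" where
    "A = mat_of_rows_list 2 [[1, 1], [1, -1]]"
    and "B = mat_of_rows_list 2 [[1, -1], [1, 1]]"
    and "C = mat_of_rows_list 2 [[-1, -1], [1, -1]]"
  note defs = A_def B_def C_def
  have lt2: "i < 2 \<longleftrightarrow> i = 0 \<or> i = Suc 0" for i :: nat by auto
  note ev = weighing_matrix_def mat_eq_iff mat_of_rows_list_def scalar_prod_def lt2
    numeral_2_eq_2 all_conj_distrib
  have ne: "A \<noteq> B" "A \<noteq> C" "B \<noteq> C"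
    by (auto simp: defs mat_eq_iff mat_of_rows_list_def numeral_2_eq_2 less_Suc_eq
        conj_disj_distribR ex_disj_distrib)
  have w: "weighing_matrix 2 2 A" "weighing_matrix 2 2 B" "weighing_matrix 2 2 C"
    by (auto simp: defs ev less_Suc_eq)
  have s: "sqrt 4 = 2" by simp
  have p: "weighing_matrix 2 1 ((1 / 2) \<cdot>\<^sub>m (X * transpose_mat Y))"
    if "X \<in> {A, B, C}" "Y \<in> {A, B, C}" for X Y
    using that by (auto simp: defs ev less_Suc_eq)
  define W where "W = (\<lambda>i::nat. if i = 1 then A else if i = 2 then B else C)"
  have I: "{1..3} = {1, 2, 3::nat}" by auto
  have "W ` {1..3} = {A, B, C}" unfolding I by (auto simp: W_def)
  moreover have "inj_on W {1..3}" unfolding I using ne by (auto simp: W_def inj_on_def)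
  moreover have "mutually_quasi_unbiased 2 2 1 4 {A, B, C}"
    unfolding mutually_quasi_unbiased_def pairwise_def quasi_unbiased_def
    using w p s by auto
  ultimately show ?thesis by metis
qed

end

theory Submission
  imports Defs "HOL-Library.Ramsey"
begin

text \<open>The rows of a set of \<open>f\<close> mutually quasi-unbiased weighing matrices of full weight \<open>d\<close>
  form \<open>N = f d\<close> sign vectors of length \<open>d\<close>, distinct ones having an inner product \<open>t\<close> with
  \<open>t\<^sup>2 \<le> a\<close>. Delsarte's linear programming method applies with the polynomial
  \<open>F(t) = t\<^sup>2 (t\<^sup>2 - a)\<close>, which is nonpositive at these values. For two sign vectors \<open>x\<close> and \<open>y\<close>
  the elementary symmetric functions \<open>e\<^sub>k\<close> of the products \<open>x\<^sub>i y\<^sub>i\<close> are positive semidefinite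
  kernels, and they are polynomials in \<open>t\<close> (the Krawtchouk polynomials). Expanding
  \<open>F = 24 e\<^sub>4 + 2 (6 d - 8 - a) e\<^sub>2 + d (3 d - 2 - a)\<close> and summing over all ordered pairs of rows
  gives \<open>N d (3 d - 2 - a) \<le> F(d)\<close>; for \<open>a = 2 d\<close> this reads \<open>f \<le> d\<close>.\<close>

definition elem_sym :: "nat \<Rightarrow> 'i set \<Rightarrow> ('i \<Rightarrow> 'a::comm_semiring_1) \<Rightarrow> 'a" where
  "elem_sym k A a = (\<Sum>S\<in>[A]\<^bsup>k\<^esup>. \<Prod>i\<in>S. a i)"

lemma elem_sym_0 [simp]: "elem_sym 0 A a = 1"
  by (simp add: elem_sym_def)

lemma sum_nsets_insert:
  assumes "finite A"
  shows "(\<Sum>S\<in>[A]\<^bsup>k\<^esup>. \<Sum>i\<in>A - S. h i (insert i S)) = (\<Sum>T\<in>[A]\<^bsup>Suc k\<^esup>. \<Sum>i\<in>T. h i T)"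
proof -
  have "(\<Sum>S\<in>[A]\<^bsup>k\<^esup>. \<Sum>i\<in>A - S. h i (insert i S)) =
      (\<Sum>(S, i)\<in>Sigma ([A]\<^bsup>k\<^esup>) (\<lambda>S. A - S). h i (insert i S))"
    using assms by (simp add: sum.Sigma finite_imp_finite_nsets)
  also have "\<dots> = (\<Sum>(T, i)\<in>Sigma ([A]\<^bsup>Suc k\<^esup>) (\<lambda>T. T). h i T)"
    by (rule sum.reindex_bij_witness
        [where i = "\<lambda>(T, i). (T - {i}, i)" and j = "\<lambda>(S, i). (insert i S, i)"])
      (auto simp: nsets_def insert_absorb)
  also have "\<dots> = (\<Sum>T\<in>[A]\<^bsup>Suc k\<^esup>. \<Sum>i\<in>T. h i T)"
    using assms by (subst sum.Sigma) (auto simp: finite_imp_finite_nsets nsets_def)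
  finally show ?thesis .
qed

lemma sum_mult_esym:
  fixes a :: "'i \<Rightarrow> 'a::comm_semiring_1"
  assumes "finite A"
  shows "sum a A * elem_sym k A a =
    of_nat (Suc k) * elem_sym (Suc k) A a + (\<Sum>S\<in>[A]\<^bsup>k\<^esup>. \<Sum>i\<in>S. a i * prod a S)"
proof -
  have "sum a A * prod a S = (\<Sum>i\<in>A - S. prod a (insert i S)) + (\<Sum>i\<in>S. a i * prod a S)"
    if "S \<in> [A]\<^bsup>k\<^esup>" for S
  proof -
    have "S \<subseteq> A" "finite S"
      using that by (auto simp: nsets_def)
    then show ?thesis
      using assms by (simp add: sum.subset_diff[of S A] distrib_right sum_distrib_right)
  qed
  then have "sum a A * elem_sym k A a = (\<Sum>S\<in>[A]\<^bsup>k\<^esup>. \<Sum>i\<in>A - S. prod a (insert i S)) +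
      (\<Sum>S\<in>[A]\<^bsup>k\<^esup>. \<Sum>i\<in>S. a i * prod a S)"
    by (simp add: elem_sym_def sum_distrib_left sum.distrib)
  also have "(\<Sum>S\<in>[A]\<^bsup>k\<^esup>. \<Sum>i\<in>A - S. prod a (insert i S)) = (\<Sum>T\<in>[A]\<^bsup>Suc k\<^esup>. \<Sum>i\<in>T. prod a T)"
    using assms by (rule sum_nsets_insert)
  also have "\<dots> = of_nat (Suc k) * elem_sym (Suc k) A a"
    unfolding elem_sym_def sum_distrib_left by (intro sum.cong) (simp_all add: nsets_def)
  finally show ?thesis .
qed

lemma elem_sym_1:
  assumes "finite A"
  shows "elem_sym (Suc 0) A a = sum a A"
  using sum_mult_esym[OF assms, of a 0] by simp

lemma elem_sym_signs_rec:
  fixes a :: "'i \<Rightarrow> 'a::comm_ring_1"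
  assumes "finite A" and sign: "\<And>i. i \<in> A \<Longrightarrow> (a i)\<^sup>2 = 1"
  shows "of_nat (Suc (Suc k)) * elem_sym (Suc (Suc k)) A a =
    sum a A * elem_sym (Suc k) A a - (of_nat (card A) - of_nat k) * elem_sym k A a"
proof -
  have "(\<Sum>T\<in>[A]\<^bsup>Suc k\<^esup>. \<Sum>i\<in>T. a i * prod a T) = (\<Sum>T\<in>[A]\<^bsup>Suc k\<^esup>. \<Sum>i\<in>T. prod a (T - {i}))"
  proof (intro sum.cong refl)
    fix T i assume "T \<in> [A]\<^bsup>Suc k\<^esup>" "i \<in> T"
    then have "finite T" "i \<in> T" "a i * a i = 1"
      using sign[of i] by (auto simp: nsets_def power2_eq_square)
    then show "a i * prod a T = prod a (T - {i})"
      by (simp add: prod.remove flip: mult.assoc)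
  qed
  also have "\<dots> = (\<Sum>S\<in>[A]\<^bsup>k\<^esup>. \<Sum>i\<in>A - S. prod a (insert i S - {i}))"
    using assms(1) by (rule sum_nsets_insert[symmetric])
  also have "\<dots> = (\<Sum>S\<in>[A]\<^bsup>k\<^esup>. (of_nat (card A) - of_nat k) * prod a S)"
  proof (rule sum.cong[OF refl])
    fix S assume "S \<in> [A]\<^bsup>k\<^esup>"
    then have "of_nat (card (A - S)) = (of_nat (card A) - of_nat k :: 'a)"
      using assms(1) by (auto simp: nsets_def card_Diff_subset card_mono)
    then show "(\<Sum>i\<in>A - S. prod a (insert i S - {i})) = (of_nat (card A) - of_nat k) * prod a S"
      by simp
  qed
  finally show ?thesis
    using sum_mult_esym[OF assms(1), of a "Suc k"] by (simp add: elem_sym_def sum_distrib_left)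
qed

lemma elem_sym_2_signs:
  fixes a :: "'i \<Rightarrow> 'a::comm_ring_1"
  assumes "finite A" "\<And>i. i \<in> A \<Longrightarrow> (a i)\<^sup>2 = 1"
  shows "2 * elem_sym 2 A a = (sum a A)\<^sup>2 - of_nat (card A)"
  using elem_sym_signs_rec[OF assms, where k = 0] assms(1)
  by (simp add: elem_sym_1 power2_eq_square numeral_2_eq_2)

lemma elem_sym_4_signs:
  fixes a :: "'i \<Rightarrow> 'a::comm_ring_1"
  assumes "finite A" "\<And>i. i \<in> A \<Longrightarrow> (a i)\<^sup>2 = 1"
  defines "t \<equiv> sum a A" and "n \<equiv> of_nat (card A)"
  shows "24 * elem_sym 4 A a = t ^ 4 - (6 * n - 8) * t\<^sup>2 + 3 * n * (n - 2)"
proof -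
  have e2: "2 * elem_sym 2 A a = t\<^sup>2 - n"
    unfolding t_def n_def by (rule elem_sym_2_signs[OF assms(1,2)])
  have e3: "3 * elem_sym 3 A a = t * elem_sym 2 A a - (n - 1) * t"
    using elem_sym_signs_rec[OF assms(1,2), where k = 1] assms(1)
    by (simp add: elem_sym_1 t_def n_def eval_nat_numeral)
  have e4: "4 * elem_sym 4 A a = t * elem_sym 3 A a - (n - 2) * elem_sym 2 A a"
    using elem_sym_signs_rec[OF assms(1,2), where k = 2] by (simp add: t_def n_def eval_nat_numeral)
  have "24 * elem_sym 4 A a = 6 * (4 * elem_sym 4 A a)"
    by simp
  also have "\<dots> = 2 * t * (3 * elem_sym 3 A a) - 3 * (n - 2) * (2 * elem_sym 2 A a)"
    unfolding e4 by (simp add: algebra_simps)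
  also have "\<dots> = (t\<^sup>2 - 3 * (n - 2)) * (2 * elem_sym 2 A a) - 2 * (n - 1) * t\<^sup>2"
    unfolding e3 by (simp add: algebra_simps power2_eq_square)
  also have "\<dots> = t ^ 4 - (6 * n - 8) * t\<^sup>2 + 3 * n * (n - 2)"
    unfolding e2 by (simp add: algebra_simps power2_eq_square power4_eq_xxxx)
  finally show ?thesis .
qed

lemma quartic_elem_sym_expansion:
  fixes a :: "'i \<Rightarrow> 'a::comm_ring_1"
  assumes "finite A" "\<And>i. i \<in> A \<Longrightarrow> (a i)\<^sup>2 = 1"
  defines "t \<equiv> sum a A" and "n \<equiv> of_nat (card A)"
  shows "t\<^sup>2 * (t\<^sup>2 - b) =
    24 * elem_sym 4 A a + (6 * n - 8 - b) * (2 * elem_sym 2 A a) + n * (3 * n - 2 - b)"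
proof -
  have "t\<^sup>2 * (t\<^sup>2 - b) = (t ^ 4 - (6 * n - 8) * t\<^sup>2 + 3 * n * (n - 2)) +
      (6 * n - 8 - b) * (t\<^sup>2 - n) + n * (3 * n - 2 - b)"
    by (simp add: algebra_simps power2_eq_square power4_eq_xxxx)
  also have "\<dots> = 24 * elem_sym 4 A a + (6 * n - 8 - b) * (2 * elem_sym 2 A a) + n * (3 * n - 2 - b)"
    by (simp only: elem_sym_2_signs[OF assms(1,2)] elem_sym_4_signs[OF assms(1,2)] t_def n_def)
  finally show ?thesis .
qed

lemma elem_sym_kernel_sum_nonneg:
  fixes x :: "'p \<Rightarrow> 'i \<Rightarrow> 'a::linordered_idom"
  shows "0 \<le> (\<Sum>p\<in>I. \<Sum>q\<in>I. elem_sym k A (\<lambda>i. x p i * x q i))"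
proof -
  have "(\<Sum>p\<in>I. \<Sum>q\<in>I. elem_sym k A (\<lambda>i. x p i * x q i)) =
      (\<Sum>p\<in>I. \<Sum>S\<in>[A]\<^bsup>k\<^esup>. \<Sum>q\<in>I. prod (x p) S * prod (x q) S)"
    by (simp add: elem_sym_def prod.distrib sum.swap[of _ I "[A]\<^bsup>k\<^esup>"])
  also have "\<dots> = (\<Sum>S\<in>[A]\<^bsup>k\<^esup>. (\<Sum>p\<in>I. prod (x p) S)\<^sup>2)"
    by (subst sum.swap) (simp add: power2_eq_square sum_product)
  also have "0 \<le> \<dots>"
    by (simp add: sum_nonneg)
  finally show ?thesis .
qed

lemma delsarte_bound:
  fixes x :: "'p \<Rightarrow> 'i \<Rightarrow> 'a::linordered_idom" and A :: "'i set" and c :: "nat \<Rightarrow> 'a" and m :: nat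
  defines "F \<equiv> \<lambda>p q. \<Sum>k\<le>m. c k * elem_sym k A (\<lambda>i. x p i * x q i)"
  assumes I: "finite I" "I \<noteq> {}"
    and c: "\<And>k. 0 < k \<Longrightarrow> 0 \<le> c k"
    and diag: "\<And>p. p \<in> I \<Longrightarrow> F p p \<le> M"
    and off_diag: "\<And>p q. p \<in> I \<Longrightarrow> q \<in> I \<Longrightarrow> p \<noteq> q \<Longrightarrow> F p q \<le> 0"
  shows "of_nat (card I) * c 0 \<le> M"
proof -
  define E where "E k = (\<Sum>p\<in>I. \<Sum>q\<in>I. elem_sym k A (\<lambda>i. x p i * x q i))" for k
  have "of_nat (card I) * (of_nat (card I) * c 0) = c 0 * E 0"
    by (simp add: E_def)
  also have "\<dots> \<le> (\<Sum>k\<le>m. c k * E k)"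
    using c by (auto simp: sum.atMost_shift E_def intro!: sum_nonneg mult_nonneg_nonneg
        elem_sym_kernel_sum_nonneg)
  also have "\<dots> = (\<Sum>p\<in>I. \<Sum>q\<in>I. F p q)"
    by (simp add: E_def F_def sum_distrib_left sum.swap[of _ I "{..m}"])
  also have "\<dots> \<le> (\<Sum>p\<in>I. \<Sum>q\<in>I. if p = q then M else 0)"
    using diag off_diag by (intro sum_mono) auto
  also have "\<dots> = of_nat (card I) * M"
    using I by simp
  finally show ?thesis
    using I by (simp add: card_gt_0_iff)
qed

lemma card_sign_vectors_bound:
  fixes x :: "'p \<Rightarrow> 'i \<Rightarrow> 'a::linordered_idom" and A :: "'i set"
  defines "g \<equiv> \<lambda>p q. \<Sum>i\<in>A. x p i * x q i" and "n \<equiv> of_nat (card A)"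
  assumes I: "finite I" "I \<noteq> {}" and A: "finite A" "A \<noteq> {}"
    and sign: "\<And>p i. p \<in> I \<Longrightarrow> i \<in> A \<Longrightarrow> (x p i)\<^sup>2 = 1"
    and g_le: "\<And>p q. p \<in> I \<Longrightarrow> q \<in> I \<Longrightarrow> p \<noteq> q \<Longrightarrow> (g p q)\<^sup>2 \<le> b"
    and b: "b \<le> 6 * n - 8"
  shows "of_nat (card I) * (3 * n - 2 - b) \<le> n * (n\<^sup>2 - b)"
proof -
  define c :: "nat \<Rightarrow> 'a" where
    "c = (\<lambda>_. 0)(0 := n * (3 * n - 2 - b), 2 := 2 * (6 * n - 8 - b), 4 := 24)"
  have F: "(\<Sum>k\<le>4. c k * elem_sym k A (\<lambda>i. x p i * x q i)) = (g p q)\<^sup>2 * ((g p q)\<^sup>2 - b)"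
    if "p \<in> I" "q \<in> I" for p q
  proof -
    have "(x p i * x q i)\<^sup>2 = 1" if "i \<in> A" for i
      using that sign \<open>p \<in> I\<close> \<open>q \<in> I\<close> by (simp add: power_mult_distrib)
    from quartic_elem_sym_expansion[OF A(1) this, where b = b] show ?thesis
      by (simp add: c_def g_def n_def eval_nat_numeral algebra_simps)
  qed
  have "of_nat (card I) * c 0 \<le> n\<^sup>2 * (n\<^sup>2 - b)"
  proof (rule delsarte_bound[where x = x and A = A and m = 4, OF I])
    show "0 \<le> c k" if "0 < k" for k
      using that b by (simp add: c_def)
    show "(\<Sum>k\<le>4. c k * elem_sym k A (\<lambda>i. x p i * x p i)) \<le> n\<^sup>2 * (n\<^sup>2 - b)" if "p \<in> I" for p
    proof -
      have "g p p = n"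
        using sign[OF that] by (simp add: g_def n_def flip: power2_eq_square)
      then show ?thesis
        using F[OF that that] by simp
    qed
    show "(\<Sum>k\<le>4. c k * elem_sym k A (\<lambda>i. x p i * x q i)) \<le> 0" if "p \<in> I" "q \<in> I" "p \<noteq> q" for p q
      using F[OF that(1,2)] g_le[OF that] by (simp add: mult_nonneg_nonpos)
  qed
  then have "n * (of_nat (card I) * (3 * n - 2 - b)) \<le> n * (n * (n\<^sup>2 - b))"
    by (simp add: c_def power2_eq_square mult_ac)
  moreover have "0 < n"
    using A by (simp add: n_def card_gt_0_iff)
  ultimately show ?thesis
    by simp
qed

lemma weighing_matrix_row_scalar_prod:
  assumes "weighing_matrix d k W" "r < d" "s < d"
  shows "row W r \<bullet> row W s = (if r = s then real k else 0)"
proof -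
  have W: "W \<in> carrier_mat d d" "W * transpose_mat W = real k \<cdot>\<^sub>m 1\<^sub>m d"
    using assms(1) by (auto simp: weighing_matrix_def)
  have "row W r \<bullet> row W s = (W * transpose_mat W) $$ (r, s)"
    using W(1) assms(2,3) by simp
  also have "\<dots> = (if r = s then real k else 0)"
    unfolding W(2) using assms(2,3) by simp
  finally show ?thesis .
qed

lemma weighing_matrix_full_weight_entry_power2:
  assumes "weighing_matrix d d W" "r < d" "i < d"
  shows "(W $$ (r, i))\<^sup>2 = 1"
proof -
  have W: "W \<in> carrier_mat d d"
    using assms by (simp add: weighing_matrix_def)
  have "(\<Sum>j = 0..<d. 1 - (W $$ (r, j))\<^sup>2) = real d - row W r \<bullet> row W r"
    using W assms(2) by (simp add: scalar_prod_def sum_subtractf power2_eq_square)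
  also have "\<dots> = 0"
    using assms by (simp add: weighing_matrix_row_scalar_prod)
  finally have "(\<Sum>j = 0..<d. 1 - (W $$ (r, j))\<^sup>2) = 0" .
  moreover have "0 \<le> 1 - (W $$ (r, j))\<^sup>2" if "j \<in> {0..<d}" for j
  proof -
    have "W $$ (r, j) \<in> {0, 1, -1}"
      using assms that by (simp add: weighing_matrix_def)
    then show ?thesis
      by auto
  qed
  ultimately have "\<forall>j\<in>{0..<d}. 1 - (W $$ (r, j))\<^sup>2 = 0"
    by (subst (asm) sum_nonneg_eq_0_iff) auto
  then show ?thesis
    using assms(3) by simp
qed

lemma quasi_unbiased_row_scalar_prod_power2_le:
  assumes "quasi_unbiased d k l a X Y" "r < d" "s < d"
  shows "(row X r \<bullet> row Y s)\<^sup>2 \<le> real a"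
proof -
  have X: "X \<in> carrier_mat d d" and Y: "Y \<in> carrier_mat d d" and a: "0 < a"
    using assms by (auto simp: quasi_unbiased_def weighing_matrix_def)
  have "((1 / sqrt (real a)) \<cdot>\<^sub>m (X * transpose_mat Y)) $$ (r, s) \<in> {0, 1, -1}"
    using assms unfolding quasi_unbiased_def weighing_matrix_def by blast
  then have "row X r \<bullet> row Y s / sqrt (real a) \<in> {0, 1, -1}"
    using X Y assms(2,3) by simp
  then have "(row X r \<bullet> row Y s / sqrt (real a))\<^sup>2 \<le> 1"
    by auto
  then show ?thesis
    using a by (simp add: power_divide)
qed

lemma mutually_quasi_unbiased_row_scalar_prod_power2_le:
  assumes "mutually_quasi_unbiased d k l a S" "X \<in> S" "Y \<in> S" "r < d" "s < d" "(X, r) \<noteq> (Y, s)"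
  shows "(row X r \<bullet> row Y s)\<^sup>2 \<le> real a"
proof (cases "X = Y")
  case True
  then show ?thesis
    using assms weighing_matrix_row_scalar_prod[of d k X r s]
    by (simp add: mutually_quasi_unbiased_def)
next
  case False
  then have "quasi_unbiased d k l a X Y"
    using assms by (auto simp: mutually_quasi_unbiased_def pairwise_def)
  then show ?thesis
    using assms by (intro quasi_unbiased_row_scalar_prod_power2_le)
qed

lemma card_mutually_quasi_unbiased_bound:
  assumes S: "mutually_quasi_unbiased d d l a S" "finite S" "S \<noteq> {}"
    and a: "real a \<le> 6 * real d - 8"
  shows "real (card S) * (3 * real d - 2 - real a) \<le> (real d)\<^sup>2 - real a"
proof -
  have d: "0 < d"
    using a by (cases d) auto
  have weighing: "weighing_matrix d d X" and carrier: "X \<in> carrier_mat d d" if "X \<in> S" for X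
    using S that by (auto simp: mutually_quasi_unbiased_def weighing_matrix_def)
  define x :: "real mat \<times> nat \<Rightarrow> nat \<Rightarrow> real" where "x = (\<lambda>(X, r) i. X $$ (r, i))"
  have x_scalar_prod: "(\<Sum>i = 0..<d. x (X, r) i * x (Y, s) i) = row X r \<bullet> row Y s"
    if "X \<in> S" "Y \<in> S" "r < d" "s < d" for X Y r s
    using carrier[OF that(1)] carrier[OF that(2)] that(3,4)
    by (simp add: x_def scalar_prod_def)
  have "real (card (S \<times> {0..<d})) * (3 * real (card {0..<d}) - 2 - real a)
      \<le> real (card {0..<d}) * ((real (card {0..<d}))\<^sup>2 - real a)"
  proof (rule card_sign_vectors_bound[where x = x])
    show "(x p i)\<^sup>2 = 1" if "p \<in> S \<times> {0..<d}" "i \<in> {0..<d}" for p i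
      using that by (auto simp: x_def intro!: weighing_matrix_full_weight_entry_power2[OF weighing])
    show "(\<Sum>i = 0..<d. x p i * x q i)\<^sup>2 \<le> real a"
      if "p \<in> S \<times> {0..<d}" "q \<in> S \<times> {0..<d}" "p \<noteq> q" for p q
    proof -
      obtain X r Y s where "p = (X, r)" "q = (Y, s)"
        by fastforce
      then show ?thesis
        using that mutually_quasi_unbiased_row_scalar_prod_power2_le[OF S(1), of X Y r s]
        by (simp add: x_scalar_prod)
    qed
  qed (use S d a in auto)
  then have "real d * (real (card S) * (3 * real d - 2 - real a)) \<le> real d * ((real d)\<^sup>2 - real a)"
    by (simp add: card_cartesian_product mult_ac)
  then show ?thesis
    using d by simp
qed

theorem theorem4p1:
  fixes d l f :: nat and W :: "nat \<Rightarrow> real mat"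
  assumes "d \<noteq> 2"
    and "real l = real d / 2"
    and "inj_on W {1..f}"
    and "mutually_quasi_unbiased d d l (2 * d) (W ` {1..f})"
  shows "f \<le> d"
proof (cases "f = 0")
  case False
  have "0 < l"
    using assms(4) by (simp add: mutually_quasi_unbiased_def)
  then have d: "2 < d"
    using assms(1,2) by linarith
  have "card (W ` {1..f}) = f"
    using assms(3) by (simp add: card_image)
  moreover have "real (card (W ` {1..f})) * (3 * real d - 2 - real (2 * d))
      \<le> (real d)\<^sup>2 - real (2 * d)"
    using False d by (intro card_mutually_quasi_unbiased_bound[OF assms(4)]) auto
  ultimately have "real f * (real d - 2) \<le> real d * (real d - 2)"
    by (simp add: power2_eq_square algebra_simps)
  then show ?thesis
    using d by simp
qed simp

end
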